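(* Let $P_1\in\mathbb{R}^{n_1\times n_1}$ and $P_2\in\mathbb{R}^{n_2\times n_2}$ be symmetric, $A_1\in\mathbb{R}^{p_1\times n_1}$, $A_2\in\mathbb{R}^{p_2\times n_2}$, $N_1\in\mathbb{R}^{n_1\times n_2}$, $M_1\in\mathbb{R}^{p_1\times n_2}$, $q_i\in\mathbb{R}^{n_i}$, $b_i\in\mathbb{R}^{p_i}$, and consider the program $$\min_{x\in\mathbb{R}^{n_1},\,\xi\in\mathbb{R}^{n_2}}\ \tfrac12x^{\mathsf T}P_1x+(q_1+N_1\xi)^{\mathsf T}x+\tfrac12\xi^{\mathsf T}P_2\xi+q_2^{\mathsf T}\xi\quad\text{s.t.}\quad A_1x+M_1\xi=b_1,\ A_2\xi=b_2.$$ With $w_1=(x,\lambda_1)$ and $w_2=(\xi,\lambda_2)$, its KKT system is $$\begin{bmatrix} K_1 & L \\ L^{\mathsf T} & K_2 \end{bmatrix}\begin{bmatrix} w_1 \\ w_2 \end{bmatrix}=\begin{bmatrix} r_1 \\ r_2 \end{bmatrix}\qquad(\ast)$$ where $$K_i=\begin{bmatrix} P_i & A_i^{\mathsf T} \\ A_i & 0 \end{bmatrix},\quad r_i=\begin{bmatrix} -q_i \\ b_i \end{bmatrix}\ (i=1,2),\quad C=\begin{bmatrix} N_1 \\ M_1 \end{bmatrix},\quad L=\begin{bmatrix} C & 0 \end{bmatrix}\in\mathbb{R}^{(n_1+p_1)\times(n_2+p_2)}.$$ Assume $P_i\succeq0$ and $K_i$ nonsingular for $i=1,2$, and $1\notin\sigma(\Gamma)$,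 where $\Gamma=K_2^{-1}L^{\mathsf T}K_1^{-1}L$. Let $w_1^\star=(x^\star,\lambda_1^\star)$, $w_2^\star=(\xi^\star,\lambda_2^\star)$ be the unique solution of $(\ast)$, and let $\xi^{(1)}$ be the primal component (the first $n_2$ entries) of the first iterate $w_2^{(1)}=K_2^{-1}(r_2-L^{\mathsf T}w_1^{(0)})$ of the block Gauss--Seidel iteration initialized at $w_1^{(0)}=0$. Let the columns of $Z$ form a basis of $\ker A_2$, let $\widehat P_2=Z^{\mathsf T}P_2Z$, and let $V_1$ be the value function of the first program. Then $\widehat P_2\succ0$ and $$\xi^{(1)}-\xi^\star=Z\widehat P_2^{-1}Z^{\mathsf T}\,\nabla V_1(\xi^\star),\qquad \nabla V_1(\xi^\star)=N_1^{\mathsf T}x^\star+M_1^{\mathsf T}\lambda_1^\star.$$ Moreover, $\xi^{(1)}=\xi^\star$ for all $q_1,q_2,b_1,b_2$ (the matrices $P_i,A_i,N_1,M_1$ being fixed) if and only if $CZ=0$, that is, $\ker A_2\subseteq\ker N_1\cap\ker M_1$.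
   Context: The first program is the open quadratic program in $x$ with input $\xi$, whose value function is $$V_1(\xi)=\inf\{\tfrac12x^{\mathsf T}P_1x+(q_1+N_1\xi)^{\mathsf T}x : x\in\mathbb{R}^{n_1},\ A_1x+M_1\xi=b_1\},\qquad \xi\in\mathbb{R}^{n_2}.$$ The block Gauss--Seidel iteration for $(\ast)$ is $w_2^{(j+1)}=K_2^{-1}(r_2-L^{\mathsf T}w_1^{(j)})$, $w_1^{(j+1)}=K_1^{-1}(r_1-Lw_2^{(j+1)})$. Under the assumptions $(\ast)$ has exactly one solution. $\widehat P_2$ is called the reduced Hessian of the second program. $\sigma(X)$ denotes the spectrum (set of complex eigenvalues) of a square matrix $X$. *)

theory Defs
  imports
    Complex_Main
    "HOL-Library.Extended_Real"
    "Jordan_Normal_Form.Matrix_Kernel"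
    "Jordan_Normal_Form.Gauss_Jordan_Elimination"
    "Jordan_Normal_Form.Spectral_Radius"
begin

text \<open>
  Vectors and matrices carry explicit dimensions, so that the degenerate cases (a program without
  equality constraints, a trivial kernel) are included.
\<close>

definition pos_semidef :: "real mat \<Rightarrow> bool" where
  "pos_semidef P \<longleftrightarrow> square_mat P \<and> transpose_mat P = P \<and>
     (\<forall>v \<in> carrier_vec (dim_row P). v \<bullet> (P *\<^sub>v v) \<ge> 0)"

definition pos_def :: "real mat \<Rightarrow> bool" where
  "pos_def P \<longleftrightarrow> square_mat P \<and> transpose_mat P = P \<and>
     (\<forall>v \<in> carrier_vec (dim_row P). v \<noteq> 0\<^sub>v (dim_row P) \<longrightarrow> v \<bullet> (P *\<^sub>v v) > 0)"

text \<open>Meaningful only for invertible matrices; on others \<^const>\<open>mat_inverse\<close> returns \<^const>\<open>None\<close>.\<close>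

definition minv :: "real mat \<Rightarrow> real mat" where
  "minv A = the (mat_inverse A)"

definition kkt_mat :: "real mat \<Rightarrow> real mat \<Rightarrow> real mat" where
  "kkt_mat P A = four_block_mat P (transpose_mat A) A (0\<^sub>m (dim_row A) (dim_row A))"

definition kkt_rhs :: "real vec \<Rightarrow> real vec \<Rightarrow> real vec" where
  "kkt_rhs q b = (- q) @\<^sub>v b"

definition pad_cols :: "real mat \<Rightarrow> nat \<Rightarrow> real mat" where
  "pad_cols C p = four_block_mat C (0\<^sub>m (dim_row C) p) (0\<^sub>m 0 (dim_col C)) (0\<^sub>m 0 p)"

definition kkt_solution ::
  "real mat \<Rightarrow> real mat \<Rightarrow> real mat \<Rightarrow> real vec \<Rightarrow> real vec \<Rightarrow> real vec \<Rightarrow> real vec \<Rightarrow> bool" where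
  "kkt_solution K1 L K2 r1 r2 w1 w2 \<longleftrightarrow>
     w1 \<in> carrier_vec (dim_col K1) \<and> w2 \<in> carrier_vec (dim_col K2) \<and>
     four_block_mat K1 L (transpose_mat L) K2 *\<^sub>v (w1 @\<^sub>v w2) = r1 @\<^sub>v r2"

definition gs_step2 :: "real mat \<Rightarrow> real mat \<Rightarrow> real vec \<Rightarrow> real vec \<Rightarrow> real vec" where
  "gs_step2 L K2 r2 w1 = minv K2 *\<^sub>v (r2 - transpose_mat L *\<^sub>v w1)"

definition gs_step1 :: "real mat \<Rightarrow> real mat \<Rightarrow> real vec \<Rightarrow> real vec \<Rightarrow> real vec" where
  "gs_step1 K1 L r1 w2 = minv K1 *\<^sub>v (r1 - L *\<^sub>v w2)"

primrec gs_w1 ::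
  "real mat \<Rightarrow> real mat \<Rightarrow> real mat \<Rightarrow> real vec \<Rightarrow> real vec \<Rightarrow> real vec \<Rightarrow> nat \<Rightarrow> real vec" where
  "gs_w1 K1 L K2 r1 r2 w0 0 = w0"
| "gs_w1 K1 L K2 r1 r2 w0 (Suc j) =
     gs_step1 K1 L r1 (gs_step2 L K2 r2 (gs_w1 K1 L K2 r1 r2 w0 j))"

text \<open>The second block of the iterate exists for \<open>j \<ge> 1\<close> only.\<close>

definition gs_w2 ::
  "real mat \<Rightarrow> real mat \<Rightarrow> real mat \<Rightarrow> real vec \<Rightarrow> real vec \<Rightarrow> real vec \<Rightarrow> nat \<Rightarrow> real vec" where
  "gs_w2 K1 L K2 r1 r2 w0 j = gs_step2 L K2 r2 (gs_w1 K1 L K2 r1 r2 w0 (j - 1))"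

text \<open>The infimum is taken in the extended reals: \<open>\<infinity>\<close> if infeasible, \<open>-\<infinity>\<close> if unbounded below.\<close>

definition value_fun ::
  "real mat \<Rightarrow> real vec \<Rightarrow> real mat \<Rightarrow> real mat \<Rightarrow> real mat \<Rightarrow> real vec \<Rightarrow> real vec \<Rightarrow> ereal" where
  "value_fun P q N A M b \<xi> =
     (INF x \<in> {x \<in> carrier_vec (dim_row P). A *\<^sub>v x + M *\<^sub>v \<xi> = b}.
        ereal (1 / 2 * (x \<bullet> (P *\<^sub>v x)) + (q + N *\<^sub>v \<xi>) \<bullet> x))"

text \<open>
  Frechet differentiability on the Euclidean space of dimension \<open>n\<close>, spelled out because the type of
  vectors of varying dimension is not a normed space. The inequality forces \<open>f\<close> to be finite
  near \<open>x\<close>.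
\<close>

definition has_gradient :: "nat \<Rightarrow> (real vec \<Rightarrow> ereal) \<Rightarrow> real vec \<Rightarrow> real vec \<Rightarrow> bool" where
  "has_gradient n f x g \<longleftrightarrow> x \<in> carrier_vec n \<and> g \<in> carrier_vec n \<and> \<bar>f x\<bar> \<noteq> \<infinity> \<and>
     (\<forall>\<epsilon>>0. \<exists>\<delta>>0. \<forall>h \<in> carrier_vec n. sqrt (h \<bullet> h) < \<delta> \<longrightarrow>
        \<bar>f (x + h) - f x - ereal (g \<bullet> h)\<bar> \<le> ereal (\<epsilon> * sqrt (h \<bullet> h)))"

definition gradient :: "nat \<Rightarrow> (real vec \<Rightarrow> ereal) \<Rightarrow> real vec \<Rightarrow> real vec" where
  "gradient n f x = (THE g. has_gradient n f x g)"

definition cols_basis_of_kernel :: "real mat \<Rightarrow> real mat \<Rightarrow> bool" where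
  "cols_basis_of_kernel Z A \<longleftrightarrow> dim_row Z = dim_col A \<and> distinct (cols Z) \<and>
     kernel.basis (dim_col A) A (set (cols Z))"

end

theory Submission
  imports Defs "Jordan_Normal_Form.DL_Rank"
begin

text \<open>
  With \<open>\<rho> = r\<^sub>1 - C \<xi>\<close> the value function is \<open>-1/2 \<rho>\<^sup>T K\<^sub>1\<^sup>-\<^sup>1 \<rho>\<close>, an exact quadratic in \<open>\<xi>\<close>, whose
  gradient at \<open>\<xi>\<^sup>\<star>\<close> is \<open>g = C\<^sup>T w\<^sub>1\<^sup>\<star>\<close>. Subtracting \<open>K\<^sub>2 w\<^sub>2\<^sup>\<star> = r\<^sub>2 - L\<^sup>T w\<^sub>1\<^sup>\<star>\<close> from \<open>K\<^sub>2 w\<^sub>2\<^sup>(\<^sup>1\<^sup>) = r\<^sub>2\<close>, the error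
  \<open>w\<^sub>2\<^sup>(\<^sup>1\<^sup>) - w\<^sub>2\<^sup>\<star>\<close> solves the KKT system of the second program with right-hand side \<open>(g, 0)\<close>; its primal part
  lies in \<open>ker A\<^sub>2\<close>, and restricting to the basis \<open>Z\<close> gives the formula. If the error vanishes for all data, then
  \<open>Z\<^sup>T C\<^sup>T w\<^sub>1\<^sup>\<star> = 0\<close>, and \<open>w\<^sub>1\<^sup>\<star>\<close> is arbitrary.
\<close>

section \<open>Scalar products and bounds on quadratic forms\<close>

lemma scalar_self_nonneg: "(v :: real vec) \<bullet> v \<ge> 0"
  by (simp add: scalar_prod_def sum_nonneg)

lemma scalar_self_eq_0_iff:
  assumes "(v :: real vec) \<in> carrier_vec n"
  shows "v \<bullet> v = 0 \<longleftrightarrow> v = 0\<^sub>v n"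
proof
  assume "v \<bullet> v = 0"
  then have "\<forall>i \<in> {0..<n}. v $ i * v $ i = 0"
    using assms by (simp add: scalar_prod_def sum_nonneg_eq_0_iff)
  then show "v = 0\<^sub>v n"
    using assms by (intro eq_vecI) auto
qed simp

text \<open>Each squared entry is a summand of \<open>h \<bullet> h\<close>, and twice the absolute
  product is at most the sum of the two squares.\<close>

lemma abs_index_mult_le:
  assumes "i < dim_vec h" "j < dim_vec h"
  shows "\<bar>h $ i * h $ j\<bar> \<le> (h :: real vec) \<bullet> h"
proof -
  have le: "(h $ i)\<^sup>2 \<le> h \<bullet> h" if "i < dim_vec h" for i
    using that member_le_sum[of i "{0..<dim_vec h}" "\<lambda>i. (h $ i)\<^sup>2"]
    by (simp add: scalar_prod_def power2_eq_square)
  have "2 * \<bar>h $ i * h $ j\<bar> \<le> (h $ i)\<^sup>2 + (h $ j)\<^sup>2"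
    using sum_squares_bound[of "\<bar>h $ i\<bar>" "\<bar>h $ j\<bar>"] by (simp add: abs_mult)
  then show ?thesis
    using le[OF assms(1)] le[OF assms(2)] by linarith
qed

text \<open>The sum of the absolute entries of \<open>Q\<close> serves as constant. The bound makes
  a quadratic remainder negligible against the norm of \<open>h\<close>.\<close>

lemma quadratic_form_bounded:
  assumes "Q \<in> carrier_mat n n"
  obtains c :: real where "c \<ge> 0"
    "\<And>h. h \<in> carrier_vec n \<Longrightarrow> \<bar>h \<bullet> (Q *\<^sub>v h)\<bar> \<le> c * (h \<bullet> h)"
proof
  let ?c = "\<Sum>i = 0..<n. \<Sum>j = 0..<n. \<bar>Q $$ (i, j)\<bar>"
  show "?c \<ge> 0" by (simp add: sum_nonneg)
  fix h :: "real vec" assume h: "h \<in> carrier_vec n"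
  have "h \<bullet> (Q *\<^sub>v h) = (\<Sum>i = 0..<n. \<Sum>j = 0..<n. Q $$ (i, j) * (h $ i * h $ j))"
    using assms h by (simp add: scalar_prod_def sum_distrib_left mult_ac)
  also have "\<bar>\<dots>\<bar> \<le> (\<Sum>i = 0..<n. \<Sum>j = 0..<n. \<bar>Q $$ (i, j) * (h $ i * h $ j)\<bar>)"
    by (intro order.trans[OF sum_abs] sum_mono order.refl)
  also have "\<dots> \<le> (\<Sum>i = 0..<n. \<Sum>j = 0..<n. \<bar>Q $$ (i, j)\<bar> * (h \<bullet> h))"
    using h abs_index_mult_le[of _ h] by (intro sum_mono) (simp add: abs_mult mult_left_mono)
  also have "\<dots> = ?c * (h \<bullet> h)"
    by (simp add: sum_distrib_right)
  finally show "\<bar>h \<bullet> (Q *\<^sub>v h)\<bar> \<le> ?c * (h \<bullet> h)" .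
qed

section \<open>Gradients of extended-real functions\<close>

text \<open>Both expansions are compared along a short multiple \<open>h\<close> of the difference
  \<open>d\<close>: there the linear terms differ by \<open>s\<close> times the norm of
  \<open>h\<close>, while the two remainders add up to at most half of that. Uniqueness gives the
  \<open>THE\<close> in \<open>gradient\<close> its meaning.\<close>

lemma has_gradient_unique:
  assumes "has_gradient n f x g" and "has_gradient n f x g'"
  shows "g = g'"
proof -
  have c: "g \<in> carrier_vec n" "g' \<in> carrier_vec n" "x \<in> carrier_vec n"
    using assms by (auto simp: has_gradient_def)
  define d where "d = g - g'"
  have d: "d \<in> carrier_vec n" using c by (simp add: d_def)
  define s where "s = sqrt (d \<bullet> d)"
  have ss: "s * s = d \<bullet> d" by (simp add: s_def scalar_self_nonneg)
  have "s = 0"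
  proof (rule ccontr)
    assume "s \<noteq> 0"
    then have s: "s > 0" using scalar_self_nonneg[of d] by (simp add: s_def)
    then have e: "s / 4 > 0" by simp
    obtain r where fx: "f x = ereal r"
      using assms(1) by (auto simp: has_gradient_def)
    from assms(1) e obtain \<delta>1 where \<delta>1: "\<delta>1 > 0"
      "\<And>h. h \<in> carrier_vec n \<Longrightarrow> sqrt (h \<bullet> h) < \<delta>1 \<Longrightarrow>
        \<bar>f (x + h) - f x - ereal (g \<bullet> h)\<bar> \<le> ereal (s / 4 * sqrt (h \<bullet> h))"
      unfolding has_gradient_def by blast
    from assms(2) e obtain \<delta>2 where \<delta>2: "\<delta>2 > 0"
      "\<And>h. h \<in> carrier_vec n \<Longrightarrow> sqrt (h \<bullet> h) < \<delta>2 \<Longrightarrow>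
        \<bar>f (x + h) - f x - ereal (g' \<bullet> h)\<bar> \<le> ereal (s / 4 * sqrt (h \<bullet> h))"
      unfolding has_gradient_def by blast
    \<comment> \<open>This makes the norm \<open>t * s\<close> of \<open>h\<close> half of the
      smaller radius, so that both estimates apply.\<close>
    define t where "t = min \<delta>1 \<delta>2 / (2 * s)"
    have t: "t > 0" using s \<delta>1(1) \<delta>2(1) by (simp add: t_def)
    define h where "h = t \<cdot>\<^sub>v d"
    have h: "h \<in> carrier_vec n" using d by (simp add: h_def)
    have "h \<bullet> h = (t * s)\<^sup>2"
      using d ss by (simp add: h_def power2_eq_square algebra_simps)
    then have sh: "sqrt (h \<bullet> h) = t * s" using t s by simp
    have lt: "t * s < \<delta>1" "t * s < \<delta>2"
      using s \<delta>1(1) \<delta>2(1) by (auto simp: t_def)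
    \<comment> \<open>An infinite value would make the left side of the estimate infinite; from here
      on the comparison takes place in the reals.\<close>
    obtain r' where fh: "f (x + h) = ereal r'"
      using \<delta>1(2)[OF h] lt fx sh by (cases "f (x + h)") auto
    have 1: "\<bar>r' - r - g \<bullet> h\<bar> \<le> s / 4 * (t * s)" "\<bar>r' - r - g' \<bullet> h\<bar> \<le> s / 4 * (t * s)"
      using \<delta>1(2)[OF h] \<delta>2(2)[OF h] lt fx fh sh by auto
    have "g \<bullet> h - g' \<bullet> h = d \<bullet> h"
      using c h by (simp add: d_def minus_scalar_prod_distrib[of _ n])
    also have "\<dots> = t * (s * s)" using d ss by (simp add: h_def)
    finally have "t * (s * s) \<le> s / 2 * (t * s)" using 1 by linarith
    moreover have "t * (s * s) > 0" using t s by simp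
    ultimately show False by (simp add: field_simps)
  qed
  then have "d = 0\<^sub>v n" using ss scalar_self_eq_0_iff[OF d] by simp
  show ?thesis
  proof (rule eq_vecI)
    fix i assume "i < dim_vec g'"
    then have "d $ i = 0" "i < n" using \<open>d = 0\<^sub>v n\<close> c by auto
    then show "g $ i = g' $ i" using c by (simp add: d_def)
  qed (use c in auto)
qed

lemma gradient_eqI: "has_gradient n f x g \<Longrightarrow> gradient n f x = g"
  unfolding gradient_def by (rule the_equality) (auto intro: has_gradient_unique)

text \<open>The expansion is exact, so the remainder is the quadratic form itself, and this is at
  most a constant times the squared norm of \<open>h\<close>.\<close>

lemma has_gradient_quadratic:
  assumes x: "x \<in> carrier_vec n" and g: "g \<in> carrier_vec n" and Q: "Q \<in> carrier_mat n n"
    and f: "\<And>h. h \<in> carrier_vec n \<Longrightarrow> f (x + h) = ereal (a + g \<bullet> h + h \<bullet> (Q *\<^sub>v h))"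
  shows "has_gradient n f x g"
proof -
  have fx: "f x = ereal a"
    using f[of "0\<^sub>v n"] x g Q by simp
  obtain c :: real where c: "c \<ge> 0"
    "\<And>h. h \<in> carrier_vec n \<Longrightarrow> \<bar>h \<bullet> (Q *\<^sub>v h)\<bar> \<le> c * (h \<bullet> h)"
    using quadratic_form_bounded[OF Q] by blast
  have "\<exists>\<delta>>0. \<forall>h \<in> carrier_vec n. sqrt (h \<bullet> h) < \<delta> \<longrightarrow>
      \<bar>f (x + h) - f x - ereal (g \<bullet> h)\<bar> \<le> ereal (\<epsilon> * sqrt (h \<bullet> h))" if \<epsilon>: "\<epsilon> > 0" for \<epsilon>
  proof (intro exI conjI ballI impI)
    \<comment> \<open>The denominator is \<open>c + 1\<close> because \<open>c\<close> may be
      zero.\<close>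
    show "\<epsilon> / (c + 1) > 0" using \<epsilon> c by simp
    fix h :: "real vec"
    assume h: "h \<in> carrier_vec n" and lt: "sqrt (h \<bullet> h) < \<epsilon> / (c + 1)"
    define s where "s = sqrt (h \<bullet> h)"
    have s: "s \<ge> 0" "s * s = h \<bullet> h" by (simp_all add: s_def scalar_self_nonneg)
    have "(c + 1) * s < \<epsilon>" using lt c by (simp add: s_def field_simps)
    then have "c * s \<le> \<epsilon>" using s by (simp add: algebra_simps)
    then have "c * s * s \<le> \<epsilon> * s" using s by (intro mult_right_mono)
    then have "\<bar>h \<bullet> (Q *\<^sub>v h)\<bar> \<le> \<epsilon> * s" using c(2)[OF h] s by (simp add: mult.assoc)
    then show "\<bar>f (x + h) - f x - ereal (g \<bullet> h)\<bar> \<le> ereal (\<epsilon> * sqrt (h \<bullet> h))"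
      using f[OF h] fx by (simp add: s_def)
  qed
  then show ?thesis using x g fx by (simp add: has_gradient_def)
qed

section \<open>Inverses, semidefinite matrices and kernel bases\<close>

text \<open>\<open>invertible_mat\<close> asserts that some inverse exists, whereas
  \<open>minv\<close> unwraps the result of \<open>mat_inverse\<close>. The link is membership in
  the units of the matrix ring, which excludes the result \<open>None\<close>.\<close>

lemma minv_inverse:
  assumes A: "A \<in> carrier_mat n n" and "invertible_mat A"
  shows minv_carrier: "minv A \<in> carrier_mat n n"
    and minv_right: "A * minv A = 1\<^sub>m n" and minv_left: "minv A * A = 1\<^sub>m n"
proof -
  obtain B where B: "inverts_mat A B" "inverts_mat B A"
    using assms(2) by (auto simp: invertible_mat_def)
  \<comment> \<open>\<open>inverts_mat\<close> leaves the shape of \<open>B\<close> open; comparing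
    the column counts in the two product identities determines it.\<close>
  have "dim_row B = n" "dim_col B = n"
    using B A by (auto simp: inverts_mat_def dest: arg_cong[where f = dim_col])
  then have "A \<in> Units (ring_mat TYPE(real) n ())"
    using A B by (auto simp: Units_def ring_mat_def inverts_mat_def)
  then obtain B' where "mat_inverse A = Some B'"
    using mat_inverse(1)[OF A, of "()"] by (cases "mat_inverse A") auto
  then show "minv A \<in> carrier_mat n n" "A * minv A = 1\<^sub>m n" "minv A * A = 1\<^sub>m n"
    using mat_inverse(2)[OF A] by (auto simp: minv_def)
qed

lemma minv_mult_vec:
  assumes "A \<in> carrier_mat n n" and "invertible_mat A" and "v \<in> carrier_vec n"
  shows "A *\<^sub>v (minv A *\<^sub>v v) = v" and "minv A *\<^sub>v (A *\<^sub>v v) = v"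
  using minv_inverse[OF assms(1,2)] assms
  by (simp_all add: assoc_mult_mat_vec[of _ n n _ n, symmetric])

text \<open>A zero determinant over a field produces a nonzero null vector. This reduces the later
  invertibility claims to kernel computations.\<close>

lemma invertible_mat_if_kernel_trivial:
  fixes A :: "'a :: field mat"
  assumes A: "A \<in> carrier_mat n n"
    and "\<And>v. v \<in> carrier_vec n \<Longrightarrow> A *\<^sub>v v = 0\<^sub>v n \<Longrightarrow> v = 0\<^sub>v n"
  shows "invertible_mat A"
proof -
  have "det A \<noteq> 0"
    using assms by (auto simp: det_0_iff_vec_prod_zero_field[OF A])
  from det_non_zero_imp_unit[OF A this, of "()"] obtain B
    where "B \<in> carrier_mat n n" "B * A = 1\<^sub>m n" "A * B = 1\<^sub>m n"
    by (auto simp: Units_def ring_mat_def)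
  then show ?thesis
    using A by (auto simp: invertible_mat_def inverts_mat_def)
qed

lemma pos_def_invertible:
  assumes "pos_def P"
  shows "invertible_mat P"
proof (rule invertible_mat_if_kernel_trivial)
  show "P \<in> carrier_mat (dim_row P) (dim_row P)"
    using assms by (auto simp: pos_def_def)
  show "v = 0\<^sub>v (dim_row P)"
    if "v \<in> carrier_vec (dim_row P)" "P *\<^sub>v v = 0\<^sub>v (dim_row P)" for v
    using assms that by (fastforce simp: pos_def_def)
qed

text \<open>Moving from \<open>u\<close> in the direction \<open>w = P u\<close>, the form equals
  \<open>2 * t * a + t\<^sup>2 * b\<close> with \<open>a = w \<bullet> w\<close>. It is nonnegative
  for both signs of \<open>t\<close>, so its slope at zero, and with it \<open>P u\<close>, must
  vanish.\<close>

lemma pos_semidef_null_vec: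
  assumes P: "pos_semidef P" "P \<in> carrier_mat n n" and u: "u \<in> carrier_vec n"
    and 0: "u \<bullet> (P *\<^sub>v u) = 0"
  shows "P *\<^sub>v u = 0\<^sub>v n"
proof -
  define w where "w = P *\<^sub>v u"
  have w: "w \<in> carrier_vec n" using P u by (simp add: w_def)
  define a b where "a = w \<bullet> w" and "b = w \<bullet> (P *\<^sub>v w)"
  have uPw: "u \<bullet> (P *\<^sub>v w) = a"
    using transpose_vec_mult_scalar[of P n n w u] P u w by (simp add: pos_semidef_def w_def a_def)
  have nonneg: "2 * t * a + t\<^sup>2 * b \<ge> 0" for t
  proof -
    have tw: "t \<cdot>\<^sub>v w \<in> carrier_vec n" using w by simp
    have "P *\<^sub>v (u + t \<cdot>\<^sub>v w) = w + t \<cdot>\<^sub>v (P *\<^sub>v w)"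
      using mult_add_distrib_mat_vec[OF P(2) u tw] mult_mat_vec[OF P(2) w] by (simp add: w_def)
    then have "(u + t \<cdot>\<^sub>v w) \<bullet> (P *\<^sub>v (u + t \<cdot>\<^sub>v w)) = u \<bullet> w + t * a + (t * a + t * (t * b))"
      using u w P(2) uPw
      by (simp add: add_scalar_prod_distrib[of _ n] scalar_prod_add_distrib[of _ n] a_def b_def
          algebra_simps)
    moreover have "(u + t \<cdot>\<^sub>v w) \<bullet> (P *\<^sub>v (u + t \<cdot>\<^sub>v w)) \<ge> 0"
      using P u w by (simp add: pos_semidef_def)
    ultimately show ?thesis using 0 by (simp add: w_def power2_eq_square algebra_simps)
  qed
  have b: "b \<ge> 0" using P w by (simp add: pos_semidef_def b_def)
  have "a = 0"
  proof (rule ccontr)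
    assume "a \<noteq> 0"
    \<comment> \<open>With this \<open>t\<close> the form becomes
      \<open>- a * a / (b + 1) - t\<^sup>2\<close>, which is negative; \<open>b + 1\<close> keeps
      the quotient meaningful when \<open>b\<close> is zero.\<close>
    define t where "t = - a / (b + 1)"
    have "t * b = - a - t" using b by (simp add: t_def field_simps)
    then have "2 * t * a + t\<^sup>2 * b = t * a - t\<^sup>2"
      by (simp add: power2_eq_square mult.assoc) (simp add: algebra_simps)
    moreover have "t * a = - (a * a / (b + 1))" by (simp add: t_def)
    moreover have "a * a / (b + 1) > 0"
      using \<open>a \<noteq> 0\<close> b by (intro divide_pos_pos) (auto simp: zero_less_mult_iff)
    ultimately show False using nonneg[of t] zero_le_power2[of t] by linarith
  qed
  then show ?thesis using scalar_self_eq_0_iff[OF w] by (simp add: a_def w_def)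
qed

text \<open>Translates the basis property of a set of columns into range and injectivity of
  \<open>Z\<close>. Injectivity also uses that the columns are distinct, since linear dependence of
  a set does not see repetitions.\<close>

lemma kernel_basis_matrix:
  assumes Z: "Z \<in> carrier_mat n k" and A: "A \<in> carrier_mat p n"
    and basis: "cols_basis_of_kernel Z A"
  shows kernel_basis_range: "mat_kernel A = {Z *\<^sub>v y | y. y \<in> carrier_vec k}"
    and kernel_basis_inj: "y \<in> carrier_vec k \<Longrightarrow> Z *\<^sub>v y = 0\<^sub>v n \<Longrightarrow> y = 0\<^sub>v k"
proof -
  interpret kernel p n A by unfold_locales (rule A)
  have b: "Ker.basis (set (cols Z))" and dist: "distinct (cols Z)"
    using basis A by (auto simp: cols_basis_of_kernel_def)
  have sub: "set (cols Z) \<subseteq> mat_kernel A" and indep: "\<not> Ker.lin_dep (set (cols Z))"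
    and span: "Ker.span (set (cols Z)) = mat_kernel A"
    using b by (auto simp: Ker.basis_def)
  \<comment> \<open>Span and linear dependence inside the kernel agree with those in the ambient
    space, where the span of the columns is the column space.\<close>
  show "mat_kernel A = {Z *\<^sub>v y | y. y \<in> carrier_vec k}"
    using span span_same[OF sub] NC.col_space_eq[OF Z] Z by (auto simp: NC.col_space_def)
  show "y = 0\<^sub>v k" if "y \<in> carrier_vec k" "Z *\<^sub>v y = 0\<^sub>v n"
    using NC.lin_depI[OF Z that(1) _ that(2) dist] indep lindep_same[OF sub] by blast
qed

section \<open>Block products with KKT matrices and padded matrices\<close>

lemma kkt_mat_carrier [simp]:
  "P \<in> carrier_mat n n \<Longrightarrow> A \<in> carrier_mat p n \<Longrightarrow> kkt_mat P A \<in> carrier_mat (n + p) (n + p)"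
  by (simp add: kkt_mat_def)

lemma kkt_rhs_carrier [simp]:
  "q \<in> carrier_vec n \<Longrightarrow> b \<in> carrier_vec p \<Longrightarrow> kkt_rhs q b \<in> carrier_vec (n + p)"
  by (simp add: kkt_rhs_def)

lemma pad_cols_carrier [simp]:
  "C \<in> carrier_mat r m \<Longrightarrow> pad_cols C p \<in> carrier_mat r (m + p)"
  by (auto simp: pad_cols_def)

lemma zero_mat_mult_vec: "v \<in> carrier_vec m \<Longrightarrow> 0\<^sub>m r m *\<^sub>v v = (0\<^sub>v r :: 'a :: semiring_0 vec)"
  by (intro eq_vecI) auto

lemma mat_mult_zero_vec: "A \<in> carrier_mat r m \<Longrightarrow> A *\<^sub>v 0\<^sub>v m = (0\<^sub>v r :: 'a :: semiring_0 vec)"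
  by (intro eq_vecI) auto

lemma smult_mat_mult_vec:
  assumes "A \<in> carrier_mat r m" "v \<in> carrier_vec m"
  shows "(a \<cdot>\<^sub>m A) *\<^sub>v v = a \<cdot>\<^sub>v (A *\<^sub>v v)"
  using assms by (intro eq_vecI) (auto simp: scalar_prod_def sum_distrib_left mult.assoc)

lemma kkt_mat_mult_vec:
  assumes "P \<in> carrier_mat n n" "A \<in> carrier_mat p n" "x \<in> carrier_vec n" "l \<in> carrier_vec p"
  shows "kkt_mat P A *\<^sub>v (x @\<^sub>v l) = (P *\<^sub>v x + transpose_mat A *\<^sub>v l) @\<^sub>v (A *\<^sub>v x)"
proof -
  have "kkt_mat P A *\<^sub>v (x @\<^sub>v l)
      = (P *\<^sub>v x + transpose_mat A *\<^sub>v l) @\<^sub>v (A *\<^sub>v x + 0\<^sub>m p p *\<^sub>v l)"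
    unfolding kkt_mat_def using assms by (subst four_block_mat_mult_vec[of _ n n _ p _ p]) auto
  then show ?thesis using assms by (simp add: zero_mat_mult_vec)
qed

lemma kkt_mat_transpose:
  assumes "P \<in> carrier_mat n n" "A \<in> carrier_mat p n" "transpose_mat P = P"
  shows "transpose_mat (kkt_mat P A) = kkt_mat P A"
  using assms by (simp add: kkt_mat_def transpose_four_block_mat[of _ n n _ p _ p])

lemma pad_cols_mult_vec:
  assumes "C \<in> carrier_mat r m" "v \<in> carrier_vec m" "l \<in> carrier_vec p"
  shows "pad_cols C p *\<^sub>v (v @\<^sub>v l) = C *\<^sub>v v"
proof -
  have "pad_cols C p *\<^sub>v (v @\<^sub>v l)
      = (C *\<^sub>v v + 0\<^sub>m r p *\<^sub>v l) @\<^sub>v (0\<^sub>m 0 m *\<^sub>v v + 0\<^sub>m 0 p *\<^sub>v l)"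
    unfolding pad_cols_def using assms
    by (subst four_block_mat_mult_vec[of _ r m _ p _ 0]) auto
  \<comment> \<open>The lower block has length 0, so appending it changes nothing.\<close>
  also have "\<dots> = C *\<^sub>v v"
    using assms by (intro eq_vecI) (auto simp: zero_mat_mult_vec)
  finally show ?thesis .
qed

text \<open>The columns of the padded matrix that belong to the second multiplier are zero. The
  resulting zero tail is what later puts the error of the first iterate into the kernel of
  \<open>A2\<close>.\<close>

lemma transpose_pad_cols_mult_vec:
  assumes C: "C \<in> carrier_mat r m" and w: "w \<in> carrier_vec r"
  shows "transpose_mat (pad_cols C p) *\<^sub>v w = (transpose_mat C *\<^sub>v w) @\<^sub>v 0\<^sub>v p"
proof (rule eq_vecI)
  fix i assume "i < dim_vec ((transpose_mat C *\<^sub>v w) @\<^sub>v 0\<^sub>v p)"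
  then have i: "i < m + p" using C by simp
  have "col (pad_cols C p) i = (if i < m then col C i else 0\<^sub>v r)"
    using C i by (intro eq_vecI) (auto simp: pad_cols_def)
  then show "(transpose_mat (pad_cols C p) *\<^sub>v w) $ i = ((transpose_mat C *\<^sub>v w) @\<^sub>v 0\<^sub>v p) $ i"
    using C w i carrier_matD[OF pad_cols_carrier[OF C, of p]] by auto
qed (use C carrier_matD[OF pad_cols_carrier[OF C, of p]] in auto)

section \<open>The value function of the first program and its gradient\<close>

text \<open>For a feasible \<open>x + d\<close> one has \<open>A d = 0\<close>, so by stationarity the first-order term in
  \<open>d\<close> vanishes.\<close>

lemma value_fun_at_kkt_point:
  assumes P: "P \<in> carrier_mat n n" "pos_semidef P" and A: "A \<in> carrier_mat p n"
    and N: "N \<in> carrier_mat n m" and M: "M \<in> carrier_mat p m"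
    and q: "q \<in> carrier_vec n" and \<xi>: "\<xi> \<in> carrier_vec m"
    and x: "x \<in> carrier_vec n" and l: "l \<in> carrier_vec p"
    and stationary: "P *\<^sub>v x + transpose_mat A *\<^sub>v l = - (q + N *\<^sub>v \<xi>)"
    and feasible: "A *\<^sub>v x + M *\<^sub>v \<xi> = b"
  shows "value_fun P q N A M b \<xi> = ereal (1 / 2 * (x \<bullet> (P *\<^sub>v x)) + (q + N *\<^sub>v \<xi>) \<bullet> x)"
  unfolding value_fun_def
proof (rule antisym)
  let ?F = "{x \<in> carrier_vec (dim_row P). A *\<^sub>v x + M *\<^sub>v \<xi> = b}"
  let ?f = "\<lambda>x. 1 / 2 * (x \<bullet> (P *\<^sub>v x)) + (q + N *\<^sub>v \<xi>) \<bullet> x"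
  define c where "c = q + N *\<^sub>v \<xi>"
  have c: "c \<in> carrier_vec n" using q N \<xi> by (simp add: c_def)
  show "(INF x \<in> ?F. ereal (?f x)) \<le> ereal (?f x)"
    using x P feasible by (intro INF_lower) simp
  show "ereal (?f x) \<le> (INF x \<in> ?F. ereal (?f x))"
  proof (rule INF_greatest)
    fix y assume "y \<in> ?F"
    then have y: "y \<in> carrier_vec n" "A *\<^sub>v y + M *\<^sub>v \<xi> = b" using P by auto
    define d where "d = y - x"
    have d: "d \<in> carrier_vec n" using x y by (simp add: d_def)
    have yd: "y = x + d" using x y by (intro eq_vecI) (auto simp: d_def)
    have "A *\<^sub>v y = A *\<^sub>v x"
    proof (rule eq_vecI)
      fix i assume "i < dim_vec (A *\<^sub>v x)"
      then show "(A *\<^sub>v y) $ i = (A *\<^sub>v x) $ i"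
        using arg_cong[OF trans[OF y(2) feasible[symmetric]], of "\<lambda>v. v $ i"] A M by simp
    qed simp
    then have Ad: "A *\<^sub>v d = 0\<^sub>v p"
      using A x y by (simp add: d_def mult_minus_distrib_mat_vec[of _ p n])
    have "(transpose_mat A *\<^sub>v l) \<bullet> d = 0"
      using transpose_vec_mult_scalar[OF A d l] l by (simp add: Ad)
    moreover have "(P *\<^sub>v x + transpose_mat A *\<^sub>v l) \<bullet> d = - (c \<bullet> d)"
      using stationary c d by (simp add: c_def[symmetric])
    ultimately have first_order: "(P *\<^sub>v x) \<bullet> d + c \<bullet> d = 0"
      using P A x l d by (simp add: add_scalar_prod_distrib[of _ n])
    have sym: "x \<bullet> (P *\<^sub>v d) = (P *\<^sub>v x) \<bullet> d"
      using transpose_vec_mult_scalar[of P n n d x] P x d by (simp add: pos_semidef_def)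
    have sym': "d \<bullet> (P *\<^sub>v x) = (P *\<^sub>v x) \<bullet> d"
      using P x d by (intro comm_scalar_prod[of _ n]) auto
    have "?f y = ?f x + ((P *\<^sub>v x) \<bullet> d + c \<bullet> d) + 1 / 2 * (d \<bullet> (P *\<^sub>v d))"
      using P x d c
      by (simp add: yd c_def[symmetric] mult_add_distrib_mat_vec[of _ n n] sym sym'
          add_scalar_prod_distrib[of _ n] scalar_prod_add_distrib[of _ n] algebra_simps)
    moreover have "d \<bullet> (P *\<^sub>v d) \<ge> 0" using P d by (simp add: pos_semidef_def)
    ultimately show "ereal (?f x) \<le> ereal (?f y)" using first_order by simp
  qed
qed

text \<open>Pairing the stationarity equation with \<open>x\<close> gives
  \<open>x \<bullet> (P x) = - (c \<bullet> x) - e \<bullet> l\<close>. Substituted into the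
  objective, this leaves minus one half of the pairing of the right-hand side
  \<open>(- c, e)\<close> with \<open>w = (x, l)\<close>.\<close>

lemma value_fun_kkt:
  assumes P: "P \<in> carrier_mat n n" "pos_semidef P" and A: "A \<in> carrier_mat p n"
    and N: "N \<in> carrier_mat n m" and M: "M \<in> carrier_mat p m"
    and q: "q \<in> carrier_vec n" and b: "b \<in> carrier_vec p" and \<xi>: "\<xi> \<in> carrier_vec m"
    and w: "w \<in> carrier_vec (n + p)"
    and kkt: "kkt_mat P A *\<^sub>v w = kkt_rhs q b - (N @\<^sub>r M) *\<^sub>v \<xi>"
  shows "value_fun P q N A M b \<xi> = ereal (- 1 / 2 * ((kkt_rhs q b - (N @\<^sub>r M) *\<^sub>v \<xi>) \<bullet> w))"
proof -
  define x l where "x = vec_first w n" and "l = vec_last w p"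
  have w_eq: "w = x @\<^sub>v l" using w by (simp add: x_def l_def)
  have x: "x \<in> carrier_vec n" and l: "l \<in> carrier_vec p" by (simp_all add: x_def l_def)
  define c e where "c = q + N *\<^sub>v \<xi>" and "e = b - M *\<^sub>v \<xi>"
  have c: "c \<in> carrier_vec n" and e: "e \<in> carrier_vec p"
    using q N M b \<xi> by (simp_all add: c_def e_def)
  have rhs: "kkt_rhs q b - (N @\<^sub>r M) *\<^sub>v \<xi> = (- c) @\<^sub>v e"
    unfolding mat_mult_append[OF N M \<xi>] kkt_rhs_def c_def e_def
    using q N M b \<xi> by (intro eq_vecI) auto
  have "(P *\<^sub>v x + transpose_mat A *\<^sub>v l) @\<^sub>v (A *\<^sub>v x) = (- c) @\<^sub>v e"
    using kkt kkt_mat_mult_vec[OF P(1) A x l] by (simp add: w_eq rhs)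
  then have stationary: "P *\<^sub>v x + transpose_mat A *\<^sub>v l = - c" and Ax: "A *\<^sub>v x = e"
    using P A x l c by (auto simp: append_vec_eq[of _ n])
  have "A *\<^sub>v x + M *\<^sub>v \<xi> = b"
    unfolding Ax e_def using b M \<xi> by (intro eq_vecI) auto
  note V = value_fun_at_kkt_point[OF P A N M q \<xi> x l stationary[unfolded c_def] this]
  have "(P *\<^sub>v x + transpose_mat A *\<^sub>v l) \<bullet> x = - (c \<bullet> x)"
    using stationary c x by simp
  moreover have "(transpose_mat A *\<^sub>v l) \<bullet> x = e \<bullet> l"
    using transpose_vec_mult_scalar[OF A x l] e l comm_scalar_prod[of l p e] by (simp add: Ax)
  moreover have "(P *\<^sub>v x) \<bullet> x = x \<bullet> (P *\<^sub>v x)"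
    using P x by (intro comm_scalar_prod[of _ n]) auto
  ultimately have "x \<bullet> (P *\<^sub>v x) = - (c \<bullet> x) - e \<bullet> l"
    using P A x l by (simp add: add_scalar_prod_distrib[of _ n])
  moreover have "((- c) @\<^sub>v e) \<bullet> w = - (c \<bullet> x) + e \<bullet> l"
    unfolding w_eq using c e x l by (simp add: scalar_prod_append[of _ n _ p])
  ultimately show ?thesis
    by (simp add: V rhs c_def[symmetric] algebra_simps)
qed

text \<open>Invertibility of the KKT matrix provides a KKT point at every shifted parameter
  \<open>\<xi> + h\<close>, namely \<open>w - \<delta>\<close> with \<open>K \<delta> = C h\<close>.
  Inserting it into the closed form of the value yields an exact quadratic in
  \<open>h\<close>.\<close>

lemma value_fun_has_gradient:
  assumes P: "P \<in> carrier_mat n n" "pos_semidef P" and A: "A \<in> carrier_mat p n"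
    and N: "N \<in> carrier_mat n m" and M: "M \<in> carrier_mat p m"
    and q: "q \<in> carrier_vec n" and b: "b \<in> carrier_vec p" and \<xi>: "\<xi> \<in> carrier_vec m"
    and inv: "invertible_mat (kkt_mat P A)"
    and w: "w \<in> carrier_vec (n + p)"
    and kkt: "kkt_mat P A *\<^sub>v w = kkt_rhs q b - (N @\<^sub>r M) *\<^sub>v \<xi>"
  shows "has_gradient m (value_fun P q N A M b) \<xi> (transpose_mat (N @\<^sub>r M) *\<^sub>v w)"
proof -
  \<comment> \<open>\<open>Q\<close> is the matrix of the second-order term:
    \<open>h \<bullet> (Q h)\<close> will be
    \<open>- 1 / 2 * (u \<bullet> \<delta>)\<close>.\<close>
  define K C Q \<rho> where "K = kkt_mat P A" and "C = N @\<^sub>r M"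
    and "Q = - (1 / 2) \<cdot>\<^sub>m (transpose_mat C * minv K * C)" and "\<rho> = kkt_rhs q b - C *\<^sub>v \<xi>"
  have K: "K \<in> carrier_mat (n + p) (n + p)" and C: "C \<in> carrier_mat (n + p) m"
    using P A N M by (simp_all add: K_def C_def)
  have Ki: "minv K \<in> carrier_mat (n + p) (n + p)"
    using minv_carrier[OF K] inv by (simp add: K_def)
  have Q: "Q \<in> carrier_mat m m" using C Ki by (simp add: Q_def)
  have \<rho>: "\<rho> \<in> carrier_vec (n + p)" using C q b \<xi> by (simp add: \<rho>_def)
  have Kw: "K *\<^sub>v w = \<rho>" using kkt by (simp add: K_def \<rho>_def C_def)
  show ?thesis
    unfolding C_def[symmetric]
  proof (rule has_gradient_quadratic[OF \<xi> _ Q])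
    show "transpose_mat C *\<^sub>v w \<in> carrier_vec m" using C w by simp
    fix h :: "real vec" assume h: "h \<in> carrier_vec m"
    define u \<delta> where "u = C *\<^sub>v h" and "\<delta> = minv K *\<^sub>v u"
    have u: "u \<in> carrier_vec (n + p)" and \<delta>: "\<delta> \<in> carrier_vec (n + p)"
      using C h Ki by (simp_all add: u_def \<delta>_def)
    have K\<delta>: "K *\<^sub>v \<delta> = u"
      using minv_mult_vec(1)[OF K _ u] inv by (simp add: \<delta>_def K_def)
    have \<xi>h: "\<xi> + h \<in> carrier_vec m" using \<xi> h by simp
    have \<rho>h: "kkt_rhs q b - C *\<^sub>v (\<xi> + h) = \<rho> - u"
      using q b C \<xi> h kkt_rhs_carrier[OF q b]
      by (intro eq_vecI) (auto simp: \<rho>_def u_def mult_add_distrib_mat_vec[OF C \<xi> h])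
    have "K *\<^sub>v (w - \<delta>) = \<rho> - u"
      using mult_minus_distrib_mat_vec[OF K w \<delta>] by (simp add: Kw K\<delta>)
    then have "value_fun P q N A M b (\<xi> + h) = ereal (- 1 / 2 * ((\<rho> - u) \<bullet> (w - \<delta>)))"
      using value_fun_kkt[OF P A N M q b \<xi>h, of "w - \<delta>"] w \<delta> \<rho>h by (simp add: K_def C_def)
    moreover have "(\<rho> - u) \<bullet> (w - \<delta>) = \<rho> \<bullet> w - \<rho> \<bullet> \<delta> - (u \<bullet> w - u \<bullet> \<delta>)"
      using \<rho> u w \<delta> minus_scalar_prod_distrib[OF \<rho> u, of "w - \<delta>"]
      by (simp add: scalar_prod_minus_distrib[of _ "n + p"])
    \<comment> \<open>By symmetry of \<open>K\<close> the two cross terms coincide; together they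
      cancel the factor one half in the linear term.\<close>
    moreover have "\<rho> \<bullet> \<delta> = u \<bullet> w"
      using transpose_vec_mult_scalar[OF K \<delta> w] kkt_mat_transpose[OF P(1) A] P(2)
        comm_scalar_prod[OF u w]
      by (simp add: pos_semidef_def Kw K\<delta> flip: K_def)
    moreover have "u \<bullet> w = (transpose_mat C *\<^sub>v w) \<bullet> h"
      using transpose_vec_mult_scalar[OF C h w] comm_scalar_prod[OF u w] by (simp add: u_def)
    moreover have "h \<bullet> (Q *\<^sub>v h) = - (1 / 2) * (u \<bullet> \<delta>)"
    proof -
      have "Q *\<^sub>v h = - (1 / 2) \<cdot>\<^sub>v (transpose_mat C *\<^sub>v \<delta>)"
        using C Ki h by (simp add: Q_def \<delta>_def u_def smult_mat_mult_vec[of _ m m]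
            assoc_mult_mat_vec[of _ m "n + p" _ m] assoc_mult_mat_vec[of _ m "n + p" _ "n + p"])
      moreover have "h \<bullet> (transpose_mat C *\<^sub>v \<delta>) = u \<bullet> \<delta>"
        using transpose_vec_mult_scalar[OF C h \<delta>] C h \<delta> comm_scalar_prod[of h m] comm_scalar_prod[OF u \<delta>]
        by (simp add: u_def)
      ultimately show ?thesis using h C \<delta> by simp
    qed
    ultimately show "value_fun P q N A M b (\<xi> + h)
        = ereal (- 1 / 2 * (\<rho> \<bullet> w) + (transpose_mat C *\<^sub>v w) \<bullet> h + h \<bullet> (Q *\<^sub>v h))"
      by (simp add: algebra_simps)
  qed
qed

section \<open>Stacked matrices, zero tests and cancellation for vectors of given dimension\<close>

lemma transpose_append_rows_mult_vec:
  assumes N: "N \<in> carrier_mat n m" and M: "M \<in> carrier_mat p m"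
    and x: "x \<in> carrier_vec n" and l: "l \<in> carrier_vec p"
  shows "transpose_mat (N @\<^sub>r M) *\<^sub>v (x @\<^sub>v l) = transpose_mat N *\<^sub>v x + transpose_mat M *\<^sub>v l"
proof (rule eq_vecI)
  note NM = carrier_matD[OF carrier_append_rows[OF N M]]
  show "dim_vec (transpose_mat (N @\<^sub>r M) *\<^sub>v (x @\<^sub>v l))
      = dim_vec (transpose_mat N *\<^sub>v x + transpose_mat M *\<^sub>v l)"
    using NM M by simp
  fix i assume "i < dim_vec (transpose_mat N *\<^sub>v x + transpose_mat M *\<^sub>v l)"
  then have i: "i < m" using M by simp
  have "col (N @\<^sub>r M) i = col N i @\<^sub>v col M i"
    using N M i NM by (intro eq_vecI) (auto simp: append_rows_def)
  moreover have "(col N i @\<^sub>v col M i) \<bullet> (x @\<^sub>v l) = col N i \<bullet> x + col M i \<bullet> l"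
    using N M x l by (intro scalar_prod_append[of _ n _ p]) auto
  ultimately show "(transpose_mat (N @\<^sub>r M) *\<^sub>v (x @\<^sub>v l)) $ i
      = (transpose_mat N *\<^sub>v x + transpose_mat M *\<^sub>v l) $ i"
    using N M i NM by simp
qed

lemma mat_eq_zero_iff:
  fixes B :: "'a :: semiring_1 mat"
  assumes B: "B \<in> carrier_mat r m"
  shows "B = 0\<^sub>m r m \<longleftrightarrow> (\<forall>y \<in> carrier_vec m. B *\<^sub>v y = 0\<^sub>v r)"
proof
  assume 0: "\<forall>y \<in> carrier_vec m. B *\<^sub>v y = 0\<^sub>v r"
  show "B = 0\<^sub>m r m"
  proof (rule eq_matI)
    fix i j assume "i < dim_row (0\<^sub>m r m :: 'a mat)" "j < dim_col (0\<^sub>m r m :: 'a mat)"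
    then have ij: "i < r" "j < m" by auto
    have "(B *\<^sub>v unit_vec m j) $ i = row B i \<bullet> unit_vec m j" using B ij by simp
    also have "\<dots> = B $$ (i, j)" using B ij by (simp add: scalar_prod_right_unit)
    finally show "B $$ (i, j) = 0\<^sub>m r m $$ (i, j)" using 0 ij by simp
  qed (use B in auto)
qed (simp add: zero_mat_mult_vec)

lemma mat_mult_uminus_vec:
  fixes A :: "'a :: ring mat"
  assumes "A \<in> carrier_mat r m" "v \<in> carrier_vec m"
  shows "A *\<^sub>v (- v) = - (A *\<^sub>v v)"
  using carrier_matD[OF assms(1)] carrier_vecD[OF assms(2)] by (intro eq_vecI) auto

lemma vec_add_eq_zeroD:
  fixes u v :: "'a :: group_add vec"
  assumes u: "u \<in> carrier_vec n" and v: "v \<in> carrier_vec n" and 0: "u + v = 0\<^sub>v n"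
  shows "v = - u"
proof (rule eq_vecI)
  fix i assume "i < dim_vec (- u)"
  then have i: "i < n" using u by simp
  have "u $ i + v $ i = 0"
    using arg_cong[OF 0, of "\<lambda>v. v $ i"] i u v by simp
  then show "v $ i = (- u) $ i"
    using i u minus_unique by fastforce
qed (use u v in simp)

lemma vec_add_right_cancel:
  fixes u v w :: "'a :: group_add vec"
  assumes u: "u \<in> carrier_vec n" and v: "v \<in> carrier_vec n" and w: "w \<in> carrier_vec n"
    and eq: "u + w = v + w"
  shows "u = v"
proof (rule eq_vecI)
  fix i assume "i < dim_vec v"
  then show "u $ i = v $ i"
    using arg_cong[OF eq, of "\<lambda>v. v $ i"] u v w by simp
qed (use u v in simp)

text \<open>Used to prescribe the solution of the KKT system first and to read off suitable problem
  data afterwards.\<close>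

lemma kkt_rhs_surj:
  assumes "r \<in> carrier_vec (n + p)"
  obtains q b where "q \<in> carrier_vec n" "b \<in> carrier_vec p" "kkt_rhs q b = r"
proof
  have "- (- vec_first r n) = vec_first r n" by (intro eq_vecI) auto
  then show "kkt_rhs (- vec_first r n) (vec_last r p) = r"
    using assms by (simp add: kkt_rhs_def)
qed auto

section \<open>Unique solvability of the coupled KKT system\<close>

lemma kkt_solution_iff:
  assumes "K1 \<in> carrier_mat a a" "K2 \<in> carrier_mat c c" "L \<in> carrier_mat a c"
    "r1 \<in> carrier_vec a"
  shows "kkt_solution K1 L K2 r1 r2 w1 w2 \<longleftrightarrow> w1 \<in> carrier_vec a \<and> w2 \<in> carrier_vec c \<and>
    K1 *\<^sub>v w1 + L *\<^sub>v w2 = r1 \<and> transpose_mat L *\<^sub>v w1 + K2 *\<^sub>v w2 = r2"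
proof -
  have "four_block_mat K1 L (transpose_mat L) K2 *\<^sub>v (w1 @\<^sub>v w2) = r1 @\<^sub>v r2 \<longleftrightarrow>
      K1 *\<^sub>v w1 + L *\<^sub>v w2 = r1 \<and> transpose_mat L *\<^sub>v w1 + K2 *\<^sub>v w2 = r2"
    if w: "w1 \<in> carrier_vec a" "w2 \<in> carrier_vec c"
  proof -
    have "four_block_mat K1 L (transpose_mat L) K2 *\<^sub>v (w1 @\<^sub>v w2)
        = (K1 *\<^sub>v w1 + L *\<^sub>v w2) @\<^sub>v (transpose_mat L *\<^sub>v w1 + K2 *\<^sub>v w2)"
      using assms w by (intro four_block_mat_mult_vec[of _ a a _ c _ c]) auto
    moreover have "K1 *\<^sub>v w1 + L *\<^sub>v w2 \<in> carrier_vec a" using assms w by simp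
    ultimately show ?thesis using assms by (simp add: append_vec_eq[of _ a])
  qed
  then show ?thesis using assms by (auto simp: kkt_solution_def)
qed

text \<open>A nonzero real fixed vector stays an eigenvector for 1 under the embedding into the
  complex numbers, so the assumption on the complex spectrum can be used over the reals.\<close>

lemma not_in_complex_spectrumD:
  assumes A: "A \<in> carrier_mat n n" and "1 \<notin> spectrum (map_mat complex_of_real A)"
    and v: "v \<in> carrier_vec n" "A *\<^sub>v v = v"
  shows "v = 0\<^sub>v n"
proof (rule ccontr)
  assume "v \<noteq> 0\<^sub>v n"
  then have "eigenvector A v 1" using A v by (auto simp: eigenvector_def)
  from of_real_hom.eigenvector_hom[OF A this, where ?'a = complex]
  have "eigenvalue (map_mat complex_of_real A) 1" by (auto simp: eigenvalue_def)
  then show False using assms(2) by (simp add: spectrum_def)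
qed

text \<open>Block elimination: for a null vector \<open>(w1, w2)\<close> the two block rows express
  each component through the other, and eliminating \<open>w1\<close> shows that \<open>w2\<close>
  is fixed by the matrix in \<open>spec\<close>. Hence \<open>w2\<close> vanishes, and then
  \<open>w1\<close> does.\<close>

lemma coupled_kkt_invertible:
  assumes K1: "K1 \<in> carrier_mat a a" and K2: "K2 \<in> carrier_mat c c" and L: "L \<in> carrier_mat a c"
    and inv: "invertible_mat K1" "invertible_mat K2"
    and spec: "1 \<notin> spectrum (map_mat complex_of_real (minv K2 * transpose_mat L * minv K1 * L))"
  shows "invertible_mat (four_block_mat K1 L (transpose_mat L) K2)"
proof (rule invertible_mat_if_kernel_trivial)
  show "four_block_mat K1 L (transpose_mat L) K2 \<in> carrier_mat (a + c) (a + c)"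
    using K1 K2 by simp
  fix v assume v: "v \<in> carrier_vec (a + c)"
    and 0: "four_block_mat K1 L (transpose_mat L) K2 *\<^sub>v v = 0\<^sub>v (a + c)"
  define w1 w2 where "w1 = vec_first v a" and "w2 = vec_last v c"
  have v_eq: "v = w1 @\<^sub>v w2" using v by (simp add: w1_def w2_def)
  have w: "w1 \<in> carrier_vec a" "w2 \<in> carrier_vec c" by (simp_all add: w1_def w2_def)
  have zero: "0\<^sub>v (a + c) = 0\<^sub>v a @\<^sub>v (0\<^sub>v c :: real vec)" by (intro eq_vecI) auto
  have "kkt_solution K1 L K2 (0\<^sub>v a) (0\<^sub>v c) w1 w2"
    using 0 w K1 K2 by (simp add: kkt_solution_def v_eq zero)
  then have eqs: "K1 *\<^sub>v w1 + L *\<^sub>v w2 = 0\<^sub>v a" "transpose_mat L *\<^sub>v w1 + K2 *\<^sub>v w2 = 0\<^sub>v c"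
    using kkt_solution_iff[OF K1 K2 L] by auto
  \<comment> \<open>The sign is moved onto \<open>w1\<close> in both rows, so that
    \<open>minv K1\<close> turns \<open>L w2\<close> into \<open>- w1\<close> and
    \<open>minv K2\<close> turns the image of \<open>- w1\<close> back into
    \<open>w2\<close>.\<close>
  have Lw: "L *\<^sub>v w2 = K1 *\<^sub>v (- w1)"
    using vec_add_eq_zeroD[OF _ _ eqs(1)] K1 L w by (simp add: mat_mult_uminus_vec[OF K1])
  have K2w: "transpose_mat L *\<^sub>v (- w1) = K2 *\<^sub>v w2"
    using vec_add_eq_zeroD[OF _ _ eqs(2)] K2 L w by (simp add: mat_mult_uminus_vec[of _ c a])
  note Ki = minv_carrier[OF K1 inv(1)] minv_carrier[OF K2 inv(2)]
  have "(minv K2 * transpose_mat L * minv K1 * L) *\<^sub>v w2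
      = minv K2 *\<^sub>v (transpose_mat L *\<^sub>v (minv K1 *\<^sub>v (L *\<^sub>v w2)))"
    using Ki L w by (simp add: assoc_mult_mat_vec[of _ c a _ c] assoc_mult_mat_vec[of _ c a _ a]
        assoc_mult_mat_vec[of _ c c _ a])
  also have "\<dots> = w2"
    using minv_mult_vec(2)[OF K1 inv(1), of "- w1"] minv_mult_vec(2)[OF K2 inv(2)] w
    by (simp add: Lw K2w)
  finally have "(minv K2 * transpose_mat L * minv K1 * L) *\<^sub>v w2 = w2" .
  moreover have "minv K2 * transpose_mat L * minv K1 * L \<in> carrier_mat c c"
    using Ki L by (auto intro!: mult_carrier_mat)
  ultimately have "w2 = 0\<^sub>v c"
    using not_in_complex_spectrumD[OF _ spec w(2)] by blast
  moreover from this have "K1 *\<^sub>v w1 = 0\<^sub>v a"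
    using eqs(1) K1 L w by (simp add: mat_mult_zero_vec)
  then have "w1 = 0\<^sub>v a"
    using minv_mult_vec(2)[OF K1 inv(1) w(1)] Ki by (simp add: mat_mult_zero_vec)
  ultimately show "v = 0\<^sub>v (a + c)" by (simp add: v_eq zero)
qed

lemma kkt_solution_ex1:
  assumes K1: "K1 \<in> carrier_mat a a" and K2: "K2 \<in> carrier_mat c c" and L: "L \<in> carrier_mat a c"
    and r: "r1 \<in> carrier_vec a" "r2 \<in> carrier_vec c"
    and inv: "invertible_mat (four_block_mat K1 L (transpose_mat L) K2)" (is "invertible_mat ?F")
  shows "\<exists>!w. kkt_solution K1 L K2 r1 r2 (fst w) (snd w)"
proof (rule ex1I)
  have F: "?F \<in> carrier_mat (a + c) (a + c)" using K1 K2 by simp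
  define v where "v = minv ?F *\<^sub>v (r1 @\<^sub>v r2)"
  have r12: "r1 @\<^sub>v r2 \<in> carrier_vec (a + c)" using r by simp
  have v: "v \<in> carrier_vec (a + c)" using minv_carrier[OF F inv] r12 by (simp add: v_def)
  show "kkt_solution K1 L K2 r1 r2 (fst (vec_first v a, vec_last v c)) (snd (vec_first v a, vec_last v c))"
    using v K1 K2 minv_mult_vec(1)[OF F inv r12] by (simp add: kkt_solution_def v_def)
  fix w assume w: "kkt_solution K1 L K2 r1 r2 (fst w) (snd w)"
  then have c: "fst w \<in> carrier_vec a" "snd w \<in> carrier_vec c"
    and sol: "?F *\<^sub>v (fst w @\<^sub>v snd w) = r1 @\<^sub>v r2"
    using K1 K2 by (auto simp: kkt_solution_def)
  have "fst w @\<^sub>v snd w = v"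
    using minv_mult_vec(2)[OF F inv, of "fst w @\<^sub>v snd w"] c by (simp add: sol v_def)
  also have "v = vec_first v a @\<^sub>v vec_last v c" using v by simp
  finally show "w = (vec_first v a, vec_last v c)"
    using c(1) by (simp add: append_vec_eq[of _ a] prod_eq_iff)
qed

section \<open>The reduced Hessian and the null-space method\<close>

text \<open>The form at \<open>y\<close> is that of \<open>P\<close> at \<open>u = Z y\<close>,
  where \<open>A u = 0\<close>. If it vanished, semidefiniteness would give \<open>P u = 0\<close>,
  so \<open>(u, 0)\<close> would be a null vector of the invertible KKT matrix; then
  \<open>u = 0\<close>, and \<open>y = 0\<close> by injectivity of \<open>Z\<close>.\<close>

lemma reduced_hessian_pos_def:
  assumes P: "P \<in> carrier_mat n n" "pos_semidef P" and A: "A \<in> carrier_mat p n"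
    and inv: "invertible_mat (kkt_mat P A)"
    and Z: "Z \<in> carrier_mat n k" "cols_basis_of_kernel Z A"
  shows "pos_def (transpose_mat Z * P * Z)"
  unfolding pos_def_def
proof (intro conjI ballI impI)
  have H: "transpose_mat Z * P * Z \<in> carrier_mat k k" using Z P by simp
  then show "square_mat (transpose_mat Z * P * Z)" by simp
  have "transpose_mat (transpose_mat Z * P * Z) = transpose_mat Z * (transpose_mat P * Z)"
    using P Z transpose_mult[of "transpose_mat Z * P" k n Z k] transpose_mult[of "transpose_mat Z" k n P n]
    by simp
  also have "\<dots> = transpose_mat Z * P * Z"
    using P Z by (simp add: pos_semidef_def assoc_mult_mat[of _ k n _ n _ k])
  finally show "transpose_mat (transpose_mat Z * P * Z) = transpose_mat Z * P * Z" .
  fix y :: "real vec"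
  assume "y \<in> carrier_vec (dim_row (transpose_mat Z * P * Z))"
    and "y \<noteq> 0\<^sub>v (dim_row (transpose_mat Z * P * Z))"
  then have y: "y \<in> carrier_vec k" "y \<noteq> 0\<^sub>v k" using Z by auto
  define u where "u = Z *\<^sub>v y"
  have u: "u \<in> carrier_vec n" using Z y by (simp add: u_def)
  have Au: "A *\<^sub>v u = 0\<^sub>v p"
    using kernel_basis_range[OF Z(1) A Z(2)] mat_kernelD(2)[OF A] y by (auto simp: u_def)
  have "(transpose_mat Z * P * Z) *\<^sub>v y = transpose_mat Z *\<^sub>v (P *\<^sub>v u)"
    using Z P y by (simp add: u_def assoc_mult_mat_vec[of _ k n _ k] assoc_mult_mat_vec[of _ k n _ n])
  moreover have "y \<bullet> (transpose_mat Z *\<^sub>v (P *\<^sub>v u)) = u \<bullet> (P *\<^sub>v u)"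
    using transpose_vec_mult_scalar[OF Z(1) y(1), of "P *\<^sub>v u"] P Z u y
      comm_scalar_prod[of y k "transpose_mat Z *\<^sub>v (P *\<^sub>v u)"] comm_scalar_prod[of u n "P *\<^sub>v u"]
    by (simp add: u_def)
  moreover have "u \<bullet> (P *\<^sub>v u) \<ge> 0" using P u by (simp add: pos_semidef_def)
  moreover have "u \<bullet> (P *\<^sub>v u) \<noteq> 0"
  proof
    assume "u \<bullet> (P *\<^sub>v u) = 0"
    then have "P *\<^sub>v u = 0\<^sub>v n" by (rule pos_semidef_null_vec[OF P(2,1) u])
    then have "kkt_mat P A *\<^sub>v (u @\<^sub>v 0\<^sub>v p) = 0\<^sub>v (n + p)"
      using kkt_mat_mult_vec[OF P(1) A u, of "0\<^sub>v p"] A Au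
      by (simp add: mat_mult_zero_vec[of _ n p]) (intro eq_vecI, auto)
    then have "u @\<^sub>v 0\<^sub>v p = 0\<^sub>v (n + p)"
      using minv_mult_vec(2)[OF kkt_mat_carrier[OF P(1) A] inv, of "u @\<^sub>v 0\<^sub>v p"] u
        minv_carrier[OF kkt_mat_carrier[OF P(1) A] inv]
      by (simp add: mat_mult_zero_vec)
    also have "0\<^sub>v (n + p) = 0\<^sub>v n @\<^sub>v (0\<^sub>v p :: real vec)" by (intro eq_vecI) auto
    finally have "u = 0\<^sub>v n" using u by (simp add: append_vec_eq[of _ n])
    then show False
      using kernel_basis_inj[OF Z(1) A Z(2) y(1)] y(2) by (simp add: u_def)
  qed
  ultimately show "y \<bullet> ((transpose_mat Z * P * Z) *\<^sub>v y) > 0" by simp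
qed

text \<open>This is \<open>A Z = 0\<close> transposed; it removes the multiplier from the
  stationarity equation.\<close>

lemma transpose_kernel_basis_mult_range:
  assumes A: "A \<in> carrier_mat p n" and Z: "Z \<in> carrier_mat n k" "cols_basis_of_kernel Z A"
    and \<mu>: "\<mu> \<in> carrier_vec p"
  shows "transpose_mat Z *\<^sub>v (transpose_mat A *\<^sub>v \<mu>) = 0\<^sub>v k"
proof -
  have "A * Z = 0\<^sub>m p k"
    unfolding mat_eq_zero_iff[OF mult_carrier_mat[OF A Z(1)]]
    using A Z kernel_basis_range[OF Z(1) A Z(2)] mat_kernelD(2)[OF A]
    by (auto simp: assoc_mult_mat_vec[of _ p n _ k])
  then have "transpose_mat Z * transpose_mat A = 0\<^sub>m k p"
    using transpose_mult[OF A Z(1)] by simp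
  then show ?thesis
    using A Z \<mu> assoc_mult_mat_vec[of "transpose_mat Z" k n "transpose_mat A" p \<mu>]
    by (simp add: zero_mat_mult_vec)
qed

text \<open>Null-space method: write \<open>e = Z y\<close> and multiply the first equation by \<open>Z\<^sup>T\<close>.\<close>

lemma null_space_solution:
  assumes P: "P \<in> carrier_mat n n" "pos_semidef P" and A: "A \<in> carrier_mat p n"
    and inv: "invertible_mat (kkt_mat P A)"
    and Z: "Z \<in> carrier_mat n k" "cols_basis_of_kernel Z A"
    and e: "e \<in> carrier_vec n" and \<mu>: "\<mu> \<in> carrier_vec p"
    and eq: "P *\<^sub>v e + transpose_mat A *\<^sub>v \<mu> = g" and Ae: "A *\<^sub>v e = 0\<^sub>v p"
  shows "e = (Z * minv (transpose_mat Z * P * Z) * transpose_mat Z) *\<^sub>v g"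
proof -
  define H where "H = transpose_mat Z * P * Z"
  have H: "H \<in> carrier_mat k k" using Z P by (simp add: H_def)
  have invH: "invertible_mat H"
    unfolding H_def by (intro pos_def_invertible reduced_hessian_pos_def[OF P A inv Z])
  have "e \<in> mat_kernel A" by (rule mat_kernelI[OF A e Ae])
  then obtain y where y: "y \<in> carrier_vec k" "e = Z *\<^sub>v y"
    using kernel_basis_range[OF Z(1) A Z(2)] by auto
  have g: "g \<in> carrier_vec n" using P A e \<mu> by (simp flip: eq)
  have "transpose_mat Z *\<^sub>v g
      = transpose_mat Z *\<^sub>v (P *\<^sub>v e) + transpose_mat Z *\<^sub>v (transpose_mat A *\<^sub>v \<mu>)"
    unfolding eq[symmetric] using P A Z e \<mu> by (intro mult_add_distrib_mat_vec[of _ k n]) auto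
  also have "\<dots> = transpose_mat Z *\<^sub>v (P *\<^sub>v e)"
    using transpose_kernel_basis_mult_range[OF A Z \<mu>] P Z e by simp
  also have "\<dots> = H *\<^sub>v y"
    using Z P y by (simp add: H_def assoc_mult_mat_vec[of _ k n _ k] assoc_mult_mat_vec[of _ k n _ n])
  finally have "minv H *\<^sub>v (transpose_mat Z *\<^sub>v g) = y"
    using minv_mult_vec(2)[OF H invH y(1)] by simp
  moreover have "(Z * minv H * transpose_mat Z) *\<^sub>v g = Z *\<^sub>v (minv H *\<^sub>v (transpose_mat Z *\<^sub>v g))"
    using Z g minv_carrier[OF H invH]
    by (simp add: assoc_mult_mat_vec[of _ n k _ n] assoc_mult_mat_vec[of _ n k _ k])
  ultimately show ?thesis by (simp add: y H_def)
qed

section \<open>The equation for the error of the first iterate\<close>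

text \<open>Starting from zero, the first iterate solves the second block row without its coupling
  term. Subtracting the true row leaves a KKT system for the error, driven by that term
  alone.\<close>

lemma first_iterate_error:
  assumes P1: "P1 \<in> carrier_mat n1 n1" and P2: "P2 \<in> carrier_mat n2 n2"
    and A1: "A1 \<in> carrier_mat p1 n1" and A2: "A2 \<in> carrier_mat p2 n2"
    and C: "C \<in> carrier_mat (n1 + p1) n2"
    and r1: "r1 \<in> carrier_vec (n1 + p1)" and r2: "r2 \<in> carrier_vec (n2 + p2)"
    and inv: "invertible_mat (kkt_mat P2 A2)"
    and \<xi>: "\<xi> \<in> carrier_vec n2" and l2: "l2 \<in> carrier_vec p2"
    and sol: "kkt_solution (kkt_mat P1 A1) (pad_cols C p2) (kkt_mat P2 A2) r1 r2 w1 (\<xi> @\<^sub>v l2)"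
    and e_def: "e = vec_first (gs_w2 (kkt_mat P1 A1) (pad_cols C p2) (kkt_mat P2 A2) r1 r2
      (0\<^sub>v (n1 + p1)) 1) n2 - \<xi>"
  obtains \<mu> where "\<mu> \<in> carrier_vec p2" "P2 *\<^sub>v e + transpose_mat A2 *\<^sub>v \<mu> = transpose_mat C *\<^sub>v w1"
    "A2 *\<^sub>v e = 0\<^sub>v p2"
proof -
  define K1 K2 L where "K1 = kkt_mat P1 A1" and "K2 = kkt_mat P2 A2" and "L = pad_cols C p2"
  have K1: "K1 \<in> carrier_mat (n1 + p1) (n1 + p1)" and K2: "K2 \<in> carrier_mat (n2 + p2) (n2 + p2)"
    and L: "L \<in> carrier_mat (n1 + p1) (n2 + p2)"
    using P1 P2 A1 A2 C by (simp_all add: K1_def K2_def L_def)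
  have inv: "invertible_mat K2" using inv by (simp add: K2_def)
  have w1: "w1 \<in> carrier_vec (n1 + p1)"
    and eq: "transpose_mat L *\<^sub>v w1 + K2 *\<^sub>v (\<xi> @\<^sub>v l2) = r2"
    using sol kkt_solution_iff[OF K1 K2 L r1] by (simp_all add: K1_def K2_def L_def)
  define v where "v = gs_w2 K1 L K2 r1 r2 (0\<^sub>v (n1 + p1)) 1"
  have LT: "transpose_mat L \<in> carrier_mat (n2 + p2) (n1 + p1)" using L by simp
  \<comment> \<open>Iterate 1 of the second block uses iterate \<open>1 - 1 = 0\<close> of the first
    block, which is the zero start vector.\<close>
  have "v = minv K2 *\<^sub>v r2"
    using r2 by (simp add: v_def gs_w2_def gs_step2_def mat_mult_zero_vec[OF LT])
  then have v: "v \<in> carrier_vec (n2 + p2)" and K2v: "K2 *\<^sub>v v = r2"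
    using minv_carrier[OF K2 inv] r2 minv_mult_vec(1)[OF K2 inv r2] by auto
  \<comment> \<open>The multiplier of the error system is the difference between the multiplier
    parts of the iterate and of the solution.\<close>
  define \<mu> where "\<mu> = vec_last v p2 - l2"
  have \<mu>: "\<mu> \<in> carrier_vec p2" using l2 by (simp add: \<mu>_def)
  have e_eq: "e = vec_first v n2 - \<xi>" by (simp add: e_def v_def K1_def K2_def L_def)
  have e: "e \<in> carrier_vec n2" using \<xi> by (simp add: e_eq)
  have "v = vec_first v n2 @\<^sub>v vec_last v p2" using v by simp
  also have "\<dots> = (e + \<xi>) @\<^sub>v (\<mu> + l2)"
    using \<xi> l2 by (auto simp: e_eq \<mu>_def intro!: arg_cong2[where f = append_vec] eq_vecI)
  also have "\<dots> = (e @\<^sub>v \<mu>) + (\<xi> @\<^sub>v l2)"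
    using append_vec_add[OF e \<xi> \<mu> l2] by simp
  finally have v_eq: "v = (e @\<^sub>v \<mu>) + (\<xi> @\<^sub>v l2)" .
  have "K2 *\<^sub>v (e @\<^sub>v \<mu>) + K2 *\<^sub>v (\<xi> @\<^sub>v l2) = transpose_mat L *\<^sub>v w1 + K2 *\<^sub>v (\<xi> @\<^sub>v l2)"
    using mult_add_distrib_mat_vec[OF K2, of "e @\<^sub>v \<mu>" "\<xi> @\<^sub>v l2"] e \<mu> \<xi> l2 K2v eq
    by (simp add: v_eq)
  then have "K2 *\<^sub>v (e @\<^sub>v \<mu>) = transpose_mat L *\<^sub>v w1"
    using vec_add_right_cancel[of "K2 *\<^sub>v (e @\<^sub>v \<mu>)" "n2 + p2"
        "transpose_mat L *\<^sub>v w1" "K2 *\<^sub>v (\<xi> @\<^sub>v l2)"] K2 LT w1 e \<mu> \<xi> l2 by simp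
  then have "(P2 *\<^sub>v e + transpose_mat A2 *\<^sub>v \<mu>) @\<^sub>v (A2 *\<^sub>v e) = (transpose_mat C *\<^sub>v w1) @\<^sub>v 0\<^sub>v p2"
    using kkt_mat_mult_vec[OF P2 A2 e \<mu>] transpose_pad_cols_mult_vec[OF C w1, of p2]
    by (simp add: K2_def L_def)
  then have "P2 *\<^sub>v e + transpose_mat A2 *\<^sub>v \<mu> = transpose_mat C *\<^sub>v w1 \<and> A2 *\<^sub>v e = 0\<^sub>v p2"
    using P2 A2 C e \<mu> w1 by (subst (asm) append_vec_eq[of _ n2]) auto
  then show thesis using that[OF \<mu>] by blast
qed

text \<open>The iterate \<open>\<xi>1\<close> is a function of the data because the equivalence lets
  them vary while the matrices stay fixed. Unique solvability is a conjunct of its own, so the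
  claims about every solution concern exactly one. Existence of a gradient is also asserted, since
  \<open>gradient\<close> is a definite description.\<close>

theorem lemma4:
  fixes n1 n2 p1 p2 k :: nat
    and P1 P2 A1 A2 N1 M1 C L K1 K2 \<Gamma> Z P2hat :: "real mat"
    and q1 q2 b1 b2 :: "real vec"
    and V1 :: "real vec \<Rightarrow> ereal"
    and \<xi>1 :: "real vec \<Rightarrow> real vec \<Rightarrow> real vec \<Rightarrow> real vec \<Rightarrow> real vec"
  assumes "P1 \<in> carrier_mat n1 n1" and "P2 \<in> carrier_mat n2 n2"
    and "A1 \<in> carrier_mat p1 n1" and "A2 \<in> carrier_mat p2 n2"
    and "N1 \<in> carrier_mat n1 n2" and "M1 \<in> carrier_mat p1 n2"
    and "q1 \<in> carrier_vec n1" and "q2 \<in> carrier_vec n2"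
    and "b1 \<in> carrier_vec p1" and "b2 \<in> carrier_vec p2"
    and "transpose_mat P1 = P1" and "transpose_mat P2 = P2"
    and "K1 = kkt_mat P1 A1" and "K2 = kkt_mat P2 A2"
    and "C = N1 @\<^sub>r M1" and "L = pad_cols C p2"
    and "pos_semidef P1" and "pos_semidef P2"
    and "invertible_mat K1" and "invertible_mat K2"
    and "\<Gamma> = minv K2 * transpose_mat L * minv K1 * L"
    and "1 \<notin> spectrum (map_mat complex_of_real \<Gamma>)"
    and "\<And>q1 q2 b1 b2. \<xi>1 q1 q2 b1 b2 =
           vec_first (gs_w2 K1 L K2 (kkt_rhs q1 b1) (kkt_rhs q2 b2) (0\<^sub>v (n1 + p1)) 1) n2"
    and "Z \<in> carrier_mat n2 k" and "cols_basis_of_kernel Z A2"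
    and "P2hat = transpose_mat Z * P2 * Z"
    and "V1 = value_fun P1 q1 N1 A1 M1 b1"
  shows "pos_def P2hat
    \<and> (\<exists>!w. kkt_solution K1 L K2 (kkt_rhs q1 b1) (kkt_rhs q2 b2) (fst w) (snd w))
    \<and> (\<forall>x \<in> carrier_vec n1. \<forall>l1 \<in> carrier_vec p1. \<forall>\<xi> \<in> carrier_vec n2. \<forall>l2 \<in> carrier_vec p2.
         kkt_solution K1 L K2 (kkt_rhs q1 b1) (kkt_rhs q2 b2) (x @\<^sub>v l1) (\<xi> @\<^sub>v l2) \<longrightarrow>
           (\<exists>g. has_gradient n2 V1 \<xi> g)
         \<and> \<xi>1 q1 q2 b1 b2 - \<xi> = (Z * minv P2hat * transpose_mat Z) *\<^sub>v gradient n2 V1 \<xi>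
         \<and> gradient n2 V1 \<xi> = transpose_mat N1 *\<^sub>v x + transpose_mat M1 *\<^sub>v l1)
    \<and> ((\<forall>q1 \<in> carrier_vec n1. \<forall>q2 \<in> carrier_vec n2. \<forall>b1 \<in> carrier_vec p1. \<forall>b2 \<in> carrier_vec p2.
          \<forall>x \<in> carrier_vec n1. \<forall>l1 \<in> carrier_vec p1. \<forall>\<xi> \<in> carrier_vec n2. \<forall>l2 \<in> carrier_vec p2.
            kkt_solution K1 L K2 (kkt_rhs q1 b1) (kkt_rhs q2 b2) (x @\<^sub>v l1) (\<xi> @\<^sub>v l2) \<longrightarrow>
              \<xi>1 q1 q2 b1 b2 = \<xi>)
        \<longleftrightarrow> C * Z = 0\<^sub>m (n1 + p1) k)
    \<and> (C * Z = 0\<^sub>m (n1 + p1) k \<longleftrightarrow> mat_kernel A2 \<subseteq> mat_kernel N1 \<inter> mat_kernel M1)"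
proof -
  note P1 = assms(1) and P2 = assms(2) and A1 = assms(3) and A2 = assms(4)
    and N1 = assms(5) and M1 = assms(6)
    and K1_def = assms(13) and K2_def = assms(14) and C_def = assms(15) and L_def = assms(16)
    and psd1 = assms(17) and psd2 = assms(18) and inv1 = assms(19) and inv2 = assms(20)
    and spec = assms(22)[unfolded assms(21)] and \<xi>1_def = assms(23)
    and Z = assms(24) and basis = assms(25) and P2hat_def = assms(26) and V1_def = assms(27)
  have K1: "K1 \<in> carrier_mat (n1 + p1) (n1 + p1)" and K2: "K2 \<in> carrier_mat (n2 + p2) (n2 + p2)"
    and C: "C \<in> carrier_mat (n1 + p1) n2"
    using P1 P2 A1 A2 N1 M1 by (simp_all add: K1_def K2_def C_def)
  have L: "L \<in> carrier_mat (n1 + p1) (n2 + p2)" using C by (simp add: L_def)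
  have CZ: "C * Z \<in> carrier_mat (n1 + p1) k" using C Z by simp
  note inv2' = inv2[unfolded K2_def]
  note range = kernel_basis_range[OF Z A2 basis]
  have rhs: "kkt_rhs q1 b1 \<in> carrier_vec (n1 + p1)" "kkt_rhs q2 b2 \<in> carrier_vec (n2 + p2)"
    using assms(7-10) by simp_all

  have pd: "pos_def P2hat"
    unfolding P2hat_def by (rule reduced_hessian_pos_def[OF P2 psd2 A2 inv2' Z basis])

  have ex1: "\<exists>!w. kkt_solution K1 L K2 (kkt_rhs q1 b1) (kkt_rhs q2 b2) (fst w) (snd w)"
    by (rule kkt_solution_ex1[OF K1 K2 L rhs coupled_kkt_invertible[OF K1 K2 L inv1 inv2 spec]])

  \<comment> \<open>The data are quantified afresh here and in \<open>error_formula\<close>, because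
    both directions of the equivalence apply these facts to other data than the fixed ones.\<close>
  have error: "\<exists>\<mu> \<in> carrier_vec p2. P2 *\<^sub>v (\<xi>1 q1 q2 b1 b2 - \<xi>) + transpose_mat A2 *\<^sub>v \<mu>
        = transpose_mat C *\<^sub>v w1 \<and> A2 *\<^sub>v (\<xi>1 q1 q2 b1 b2 - \<xi>) = 0\<^sub>v p2"
    if "q1 \<in> carrier_vec n1" "q2 \<in> carrier_vec n2" "b1 \<in> carrier_vec p1" "b2 \<in> carrier_vec p2"
      "\<xi> \<in> carrier_vec n2" "l2 \<in> carrier_vec p2"
      "kkt_solution K1 L K2 (kkt_rhs q1 b1) (kkt_rhs q2 b2) w1 (\<xi> @\<^sub>v l2)"
    for q1 q2 b1 b2 w1 \<xi> l2
    using first_iterate_error[OF P1 P2 A1 A2 C kkt_rhs_carrier[OF that(1,3)]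
        kkt_rhs_carrier[OF that(2,4)] inv2' that(5,6) that(7)[unfolded K1_def K2_def L_def] refl]
    unfolding \<xi>1_def K1_def K2_def L_def by metis
  have error_formula: "\<xi>1 q1 q2 b1 b2 - \<xi> = (Z * minv P2hat * transpose_mat Z) *\<^sub>v (transpose_mat C *\<^sub>v w1)"
    if c: "q1 \<in> carrier_vec n1" "q2 \<in> carrier_vec n2" "b1 \<in> carrier_vec p1" "b2 \<in> carrier_vec p2"
      "\<xi> \<in> carrier_vec n2" "l2 \<in> carrier_vec p2"
      "kkt_solution K1 L K2 (kkt_rhs q1 b1) (kkt_rhs q2 b2) w1 (\<xi> @\<^sub>v l2)"
    for q1 q2 b1 b2 w1 \<xi> l2
  proof -
    have e: "\<xi>1 q1 q2 b1 b2 - \<xi> \<in> carrier_vec n2"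
      using c(5) by (simp add: \<xi>1_def)
    show ?thesis
      using error[OF c] null_space_solution[OF P2 psd2 A2 inv2' Z basis e] by (auto simp: P2hat_def)
  qed

  have main: "(\<exists>g. has_gradient n2 V1 \<xi> g)
      \<and> \<xi>1 q1 q2 b1 b2 - \<xi> = (Z * minv P2hat * transpose_mat Z) *\<^sub>v gradient n2 V1 \<xi>
      \<and> gradient n2 V1 \<xi> = transpose_mat N1 *\<^sub>v x + transpose_mat M1 *\<^sub>v l1"
    if x: "x \<in> carrier_vec n1" "l1 \<in> carrier_vec p1" and \<xi>: "\<xi> \<in> carrier_vec n2" "l2 \<in> carrier_vec p2"
      and sol: "kkt_solution K1 L K2 (kkt_rhs q1 b1) (kkt_rhs q2 b2) (x @\<^sub>v l1) (\<xi> @\<^sub>v l2)"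
    for x l1 \<xi> l2
  proof -
    have w1: "x @\<^sub>v l1 \<in> carrier_vec (n1 + p1)" using x by simp
    \<comment> \<open>The first block row says that \<open>(x, l1)\<close> is a KKT point of the
      first program at the parameter \<open>\<xi>\<close>, as the gradient lemma requires.\<close>
    have "K1 *\<^sub>v (x @\<^sub>v l1) + L *\<^sub>v (\<xi> @\<^sub>v l2) = kkt_rhs q1 b1"
      using sol kkt_solution_iff[OF K1 K2 L rhs(1)] by simp
    then have eq: "K1 *\<^sub>v (x @\<^sub>v l1) + C *\<^sub>v \<xi> = kkt_rhs q1 b1"
      using pad_cols_mult_vec[OF C \<xi>] by (simp add: L_def)
    have "K1 *\<^sub>v (x @\<^sub>v l1) = kkt_rhs q1 b1 - C *\<^sub>v \<xi>"
      unfolding eq[symmetric] using K1 C w1 \<xi> by (intro eq_vecI) auto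
    then have grad: "has_gradient n2 V1 \<xi> (transpose_mat C *\<^sub>v (x @\<^sub>v l1))"
      unfolding V1_def C_def K1_def
      using inv1 by (intro value_fun_has_gradient[OF P1 psd1 A1 N1 M1 assms(7,9) \<xi>(1) _ w1])
        (simp_all add: K1_def)
    then show ?thesis
      using error_formula[OF assms(7-10) \<xi> sol] transpose_append_rows_mult_vec[OF N1 M1 x]
      by (auto simp: gradient_eqI[OF grad] C_def)
  qed

  have CZ_iff: "C * Z = 0\<^sub>m (n1 + p1) k \<longleftrightarrow> (\<forall>v \<in> mat_kernel A2. C *\<^sub>v v = 0\<^sub>v (n1 + p1))"
    unfolding mat_eq_zero_iff[OF CZ] range
    using assoc_mult_mat_vec[OF C Z] by auto
  have CZT: "(transpose_mat C *\<^sub>v w) \<bullet> (Z *\<^sub>v y) = w \<bullet> ((C * Z) *\<^sub>v y)"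
    if "w \<in> carrier_vec (n1 + p1)" "y \<in> carrier_vec k" for w y
    using transpose_vec_mult_scalar[OF C _ that(1), of "Z *\<^sub>v y"] Z C that by simp

  have exact: "\<xi>1 q1 q2 b1 b2 = \<xi>"
    if CZ0: "C * Z = 0\<^sub>m (n1 + p1) k"
      and c: "q1 \<in> carrier_vec n1" "q2 \<in> carrier_vec n2" "b1 \<in> carrier_vec p1" "b2 \<in> carrier_vec p2"
      "\<xi> \<in> carrier_vec n2" "l2 \<in> carrier_vec p2"
      "kkt_solution K1 L K2 (kkt_rhs q1 b1) (kkt_rhs q2 b2) w1 (\<xi> @\<^sub>v l2)"
    for q1 q2 b1 b2 w1 \<xi> l2
  proof -
    have w1: "w1 \<in> carrier_vec (n1 + p1)" using c(7) K1 by (simp add: kkt_solution_def)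
    \<comment> \<open>Transposing \<open>C Z = 0\<close> annihilates the vector to which the error
      formula applies \<open>Z * minv P2hat\<close>.\<close>
    have "transpose_mat Z * transpose_mat C = 0\<^sub>m k (n1 + p1)"
      using transpose_mult[OF C Z] CZ0 by simp
    then have ZTg: "transpose_mat Z *\<^sub>v (transpose_mat C *\<^sub>v w1) = 0\<^sub>v k"
      using C Z w1 assoc_mult_mat_vec[of "transpose_mat Z" k n2 "transpose_mat C" "n1 + p1" w1]
      by (simp add: zero_mat_mult_vec)
    have H: "P2hat \<in> carrier_mat k k" using Z by (auto simp: P2hat_def)
    have Zi: "Z * minv P2hat \<in> carrier_mat n2 k"
      using Z minv_carrier[OF H pos_def_invertible[OF pd]] by simp
    have "\<xi>1 q1 q2 b1 b2 - \<xi> = (Z * minv P2hat) *\<^sub>v (transpose_mat Z *\<^sub>v (transpose_mat C *\<^sub>v w1))"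
      unfolding error_formula[OF c] using Zi Z C w1 by (intro assoc_mult_mat_vec) auto
    then have 0: "\<xi>1 q1 q2 b1 b2 - \<xi> = 0\<^sub>v n2" using Zi by (simp add: ZTg mat_mult_zero_vec)
    have dim: "dim_vec (\<xi>1 q1 q2 b1 b2) = n2" by (simp add: \<xi>1_def)
    show ?thesis
    proof (rule eq_vecI)
      fix i assume "i < dim_vec \<xi>"
      then show "\<xi>1 q1 q2 b1 b2 $ i = \<xi> $ i"
        using arg_cong[OF 0, of "\<lambda>v. v $ i"] c(5) dim by simp
    qed (use dim c(5) in simp)
  qed

  have only_if: "C * Z = 0\<^sub>m (n1 + p1) k"
    if all: "\<forall>q1 \<in> carrier_vec n1. \<forall>q2 \<in> carrier_vec n2. \<forall>b1 \<in> carrier_vec p1. \<forall>b2 \<in> carrier_vec p2.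
          \<forall>x \<in> carrier_vec n1. \<forall>l1 \<in> carrier_vec p1. \<forall>\<xi> \<in> carrier_vec n2. \<forall>l2 \<in> carrier_vec p2.
            kkt_solution K1 L K2 (kkt_rhs q1 b1) (kkt_rhs q2 b2) (x @\<^sub>v l1) (\<xi> @\<^sub>v l2) \<longrightarrow>
              \<xi>1 q1 q2 b1 b2 = \<xi>"
    unfolding mat_eq_zero_iff[OF CZ]
  proof
    fix y :: "real vec" assume y: "y \<in> carrier_vec k"
    \<comment> \<open>Choose the data so that \<open>w\<^sub>1\<^sup>\<star> = C Z y\<close> and \<open>w\<^sub>2\<^sup>\<star> = 0\<close>.\<close>
    define w where "w = (C * Z) *\<^sub>v y"
    have w: "w \<in> carrier_vec (n1 + p1)" using CZ y by (simp add: w_def)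
    have LTw: "transpose_mat L *\<^sub>v w \<in> carrier_vec (n2 + p2)" using L w by simp
    \<comment> \<open>With second component zero, the block rows of the system reduce to
      \<open>K1 w\<close> and \<open>L^T w\<close> as right-hand sides.\<close>
    obtain q b where qb: "q \<in> carrier_vec n1" "b \<in> carrier_vec p1" "kkt_rhs q b = K1 *\<^sub>v w"
      using kkt_rhs_surj[of "K1 *\<^sub>v w" n1 p1] K1 w by auto
    obtain q' b' where qb': "q' \<in> carrier_vec n2" "b' \<in> carrier_vec p2"
      "kkt_rhs q' b' = transpose_mat L *\<^sub>v w"
      using kkt_rhs_surj[OF LTw] by blast
    have zero: "0\<^sub>v n2 @\<^sub>v 0\<^sub>v p2 = (0\<^sub>v (n2 + p2) :: real vec)" by (intro eq_vecI) auto
    have sol: "kkt_solution K1 L K2 (kkt_rhs q b) (kkt_rhs q' b') w (0\<^sub>v n2 @\<^sub>v 0\<^sub>v p2)"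
      unfolding kkt_solution_iff[OF K1 K2 L kkt_rhs_carrier[OF qb(1,2)]] zero
      using w K1 LTw
      by (simp add: qb(3) qb'(3) mat_mult_zero_vec[OF L] mat_mult_zero_vec[OF K2])
    \<comment> \<open>The assumption \<open>all\<close> speaks of solutions split into primal and
      multiplier parts, so \<open>w\<close> is split accordingly.\<close>
    have "w = vec_first w n1 @\<^sub>v vec_last w p1" using w by simp
    then have "\<xi>1 q q' b b' = 0\<^sub>v n2"
      using all qb(1,2) qb'(1,2) sol vec_first_carrier[of w n1] vec_last_carrier[of w p1]
        zero_carrier_vec by metis
    then have "\<xi>1 q q' b b' - 0\<^sub>v n2 = 0\<^sub>v n2" by simp
    \<comment> \<open>For zero error the error equation puts \<open>C^T w\<close> into the range of
      \<open>A2^T\<close>, which is orthogonal to the kernel vector \<open>Z y\<close>. This avoids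
      cancelling \<open>Z\<close> and the inverse reduced Hessian in the error formula.\<close>
    with error[OF qb(1) qb'(1) qb(2) qb'(2) _ _ sol] obtain \<mu> where \<mu>: "\<mu> \<in> carrier_vec p2"
      "P2 *\<^sub>v 0\<^sub>v n2 + transpose_mat A2 *\<^sub>v \<mu> = transpose_mat C *\<^sub>v w" by auto
    then have g: "transpose_mat C *\<^sub>v w = transpose_mat A2 *\<^sub>v \<mu>"
      using A2 P2 by (simp add: mat_mult_zero_vec)
    have "Z *\<^sub>v y \<in> mat_kernel A2" using y range by auto
    then have "A2 *\<^sub>v (Z *\<^sub>v y) = 0\<^sub>v p2" by (rule mat_kernelD(2)[OF A2])
    then have "(transpose_mat A2 *\<^sub>v \<mu>) \<bullet> (Z *\<^sub>v y) = 0"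
      using transpose_vec_mult_scalar[OF A2 _ \<mu>(1), of "Z *\<^sub>v y"] Z y \<mu>(1) by simp
    \<comment> \<open>Since \<open>w = C Z y\<close>, the pairing of \<open>C^T w\<close> with
      \<open>Z y\<close> is \<open>w \<bullet> w\<close>.\<close>
    then have "w \<bullet> w = 0" using CZT[OF w y] unfolding g w_def[symmetric] by simp
    then show "(C * Z) *\<^sub>v y = 0\<^sub>v (n1 + p1)"
      using scalar_self_eq_0_iff[OF w] by (simp add: w_def)
  qed

  have "C *\<^sub>v v = 0\<^sub>v (n1 + p1) \<longleftrightarrow> N1 *\<^sub>v v = 0\<^sub>v n1 \<and> M1 *\<^sub>v v = 0\<^sub>v p1"
    if "v \<in> carrier_vec n2" for v
  proof -
    have "0\<^sub>v (n1 + p1) = 0\<^sub>v n1 @\<^sub>v (0\<^sub>v p1 :: real vec)" by (intro eq_vecI) auto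
    then show ?thesis
      using N1 M1 that append_vec_eq[of "N1 *\<^sub>v v" n1 "0\<^sub>v n1"] by (simp add: C_def mat_mult_append)
  qed
  then have kernels: "C * Z = 0\<^sub>m (n1 + p1) k \<longleftrightarrow> mat_kernel A2 \<subseteq> mat_kernel N1 \<inter> mat_kernel M1"
    unfolding CZ_iff mat_kernel[OF A2] mat_kernel[OF N1] mat_kernel[OF M1] by auto

  show ?thesis
    using pd ex1 main exact only_if kernels by (intro conjI iffI ballI impI) blast+
qed

end
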